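(* Let $\Xi(x)=\xi^{(m)}\mathbf b_m(x)$ and $\Psi(x)=\psi^{(n)}\mathbf b_n(x)$ be two polynomials given in the Bernstein polynomial basis over $[a,b]$ of degrees $m$ and $n$, respectively, where $\xi^{(m)}=[\xi_0\ \cdots\ \xi_m]$ and $\psi^{(n)}=[\psi_0\ \cdots\ \psi_n]$. Then $$\Xi(x)\Psi(x)=\mathbf c\,\mathbf b_{m+n}(x),$$ where the row vector $\mathbf c$ of size $m+n+1$ can be found in either of the following two forms: (1) $\mathbf c=\xi^{(m)}\mathbf\Gamma_{\psi,m+n}$, where $\mathbf\Gamma_{\psi,m+n}$ is the $(m+1)\times(m+n+1)$ matrix with entries $\mathbf\Gamma_{\psi,m+n}[i,j]=\psi_{j-i}\,\mathbf T_{m,m+n}[i,j]$; (2) $\mathbf c=\psi^{(n)}\mathbf\Gamma_{\xi,m+n}$, where $\mathbf\Gamma_{\xi,m+n}$ is the $(n+1)\times(m+n+1)$ matrix with entries $\mathbf\Gamma_{\xi,m+n}[i,j]=\xi_{j-i}\,\mathbf T_{n,m+n}[i,j]$. Here $\psi_{l}$ and $\xi_l$ are taken to be $0$ whenever the index $l$ is out of range ($l<0$, or $l>n$ for $\psi_l$, or $l>m$ for $\xi_l$).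
   Context: The Bernstein polynomials of degree $N$ on $[a,b]$ ($a<b$) are $b_{j,N}(x)=\binom Nj\frac{(x-a)^j(b-x)^{N-j}}{(b-a)^N}$, $j=0,\dots,N$, and $\mathbf b_N(x)=[b_{0,N}(x),\dots,b_{N,N}(x)]^T$. The Bernstein lifting matrix $\mathbf T_{p,q}$ is the $(p+1)\times(q+1)$ matrix with entries $\mathbf T_{p,q}[i,j]=\binom{p}{i-1}\binom{q-p}{j-i}/\binom{q}{j-1}$ if $i\le j$ and $0$ otherwise (with $\binom rs=0$ for $s>r$). *)

theory Defs
  imports Complex_Main "Jordan_Normal_Form.Matrix"
begin

definition bernstein_poly :: "real \<Rightarrow> real \<Rightarrow> nat \<Rightarrow> nat \<Rightarrow> real \<Rightarrow> real" where
  "bernstein_poly a b N j x =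
     real (N choose j) * ((x - a) ^ j * (b - x) ^ (N - j)) / (b - a) ^ N"

definition bernstein_vec :: "real \<Rightarrow> real \<Rightarrow> nat \<Rightarrow> real \<Rightarrow> real vec" where
  "bernstein_vec a b N x = vec (N + 1) (\<lambda>j. bernstein_poly a b N j x)"

text \<open>Matrix rows and columns are counted from 0, so the entry \<open>(i, j)\<close> below is the
  1-based entry \<open>[i + 1, j + 1]\<close>. The lifting matrix is only meaningful for \<open>p \<le> q\<close>
  (the subtraction \<open>q - p\<close> is truncated otherwise).\<close>

definition lifting_mat :: "nat \<Rightarrow> nat \<Rightarrow> real mat" where
  "lifting_mat p q = mat (p + 1) (q + 1)
     (\<lambda>(i, j). if i \<le> j
        then real (p choose i) * real ((q - p) choose (j - i)) / real (q choose j)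
        else 0)"

text \<open>The index is an integer, so that differences of indices are not truncated.\<close>

definition coeff_ext :: "real vec \<Rightarrow> int \<Rightarrow> real" where
  "coeff_ext v l = (if 0 \<le> l \<and> l < int (dim_vec v) then v $ nat l else 0)"

definition gamma_mat :: "real vec \<Rightarrow> nat \<Rightarrow> nat \<Rightarrow> real mat" where
  "gamma_mat v p q = mat (p + 1) (q + 1)
     (\<lambda>(i, j). coeff_ext v (int j - int i) * lifting_mat p q $$ (i, j))"

end

theory Submission
  imports Defs
begin

text \<open>Both row vectors equal, entrywise, the Cauchy product of the scaled coefficients
  \<open>\<xi>\<^sub>i (m choose i)\<close> and \<open>\<psi>\<^sub>j (n choose j)\<close>, divided by \<open>(m + n) choose k\<close>. This expression is
  symmetric in the two factors, and it is what multiplying homogeneous polynomials in \<open>x - a\<close>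
  and \<open>b - x\<close> produces.\<close>

definition scaled_coeff :: "nat \<Rightarrow> real vec \<Rightarrow> nat \<Rightarrow> real" where
  "scaled_coeff N v i = coeff_ext v (int i) * real (N choose i)"

lemma scaled_coeff_eq_0: "N < i \<Longrightarrow> scaled_coeff N v i = 0"
  by (simp add: scaled_coeff_def)

text \<open>Expanding the product gives a sum over the rectangle \<open>i \<le> m\<close>,
  \<open>j \<le> n\<close>; grouping by \<open>k = i + j\<close> gives a sum over a triangle. The
  two agree because \<open>f\<close> and \<open>g\<close> vanish beyond their degrees.\<close>

lemma homogeneous_product:
  fixes f g :: "nat \<Rightarrow> 'a::comm_semiring_1"
  assumes f: "\<And>i. m < i \<Longrightarrow> f i = 0" and g: "\<And>j. n < j \<Longrightarrow> g j = 0"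
  shows "(\<Sum>i\<le>m. f i * (u ^ i * v ^ (m - i))) * (\<Sum>j\<le>n. g j * (u ^ j * v ^ (n - j)))
    = (\<Sum>k\<le>m + n. (\<Sum>i\<le>k. f i * g (k - i)) * (u ^ k * v ^ (m + n - k)))"
proof -
  let ?h = "\<lambda>i j. f i * g j * (u ^ (i + j) * v ^ (m + n - (i + j)))"
  have "(\<Sum>k\<le>m + n. (\<Sum>i\<le>k. f i * g (k - i)) * (u ^ k * v ^ (m + n - k)))
      = (\<Sum>k\<le>m + n. \<Sum>i\<le>k. ?h i (k - i))"
    by (simp add: sum_distrib_right)
  also have "\<dots> = (\<Sum>(i, j) \<in> {(i, j). i + j \<le> m + n}. ?h i j)"
    by (rule sum.triangle_reindex_eq [symmetric])
  \<comment> \<open>The rectangle lies inside the triangle, and outside it \<open>f i\<close> or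
    \<open>g j\<close> is 0.\<close>
  also have "\<dots> = (\<Sum>(i, j) \<in> {..m} \<times> {..n}. ?h i j)"
  proof (rule sum.mono_neutral_right)
    show "finite {(i, j). i + j \<le> m + n}"
      by (rule finite_subset [of _ "{..m + n} \<times> {..m + n}"]) auto
  qed (use f g in \<open>auto simp flip: not_less\<close>)
  also have "\<dots> = (\<Sum>i\<le>m. \<Sum>j\<le>n. ?h i j)"
    by (rule sum.cartesian_product [symmetric])
  also have "\<dots> = (\<Sum>i\<le>m. \<Sum>j\<le>n. (f i * (u ^ i * v ^ (m - i))) * (g j * (u ^ j * v ^ (n - j))))"
  proof (intro sum.cong refl)
    fix i j assume "i \<in> {..m}" "j \<in> {..n}"
    \<comment> \<open>Subtraction is truncated, so the exponent can be split only after the indices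
      are confined to the rectangle.\<close>
    then have "m + n - (i + j) = (m - i) + (n - j)"
      by simp
    then show "?h i j = (f i * (u ^ i * v ^ (m - i))) * (g j * (u ^ j * v ^ (n - j)))"
      by (simp add: power_add mult_ac)
  qed
  finally show ?thesis
    by (simp add: sum_product)
qed

text \<open>Moving the binomials into the coefficients and the common denominator out of the sum
  leaves a homogeneous polynomial in \<open>x - a\<close> and \<open>b - x\<close>, the form that
  \<open>homogeneous_product\<close> multiplies.\<close>

lemma scalar_prod_bernstein_vec:
  assumes "v \<in> carrier_vec (N + 1)"
  shows "v \<bullet> bernstein_vec a b N x
    = (\<Sum>i\<le>N. scaled_coeff N v i * ((x - a) ^ i * (b - x) ^ (N - i))) / (b - a) ^ N"
  using assms
  by (auto simp: scalar_prod_def bernstein_vec_def bernstein_poly_def scaled_coeff_def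
      coeff_ext_def sum_divide_distrib atLeast0LessThan lessThan_Suc_atMost mult_ac
      intro!: sum.cong)

text \<open>For \<open>q = m + n\<close> the lifting entry is
  \<open>(m choose i) * (n choose (k - i)) / ((m + n) choose k)\<close>, so its numerator supplies
  exactly the two scaling factors.\<close>

lemma row_times_gamma_mat:
  assumes v: "v \<in> carrier_vec (m + 1)" and k: "k \<le> m + n"
  shows "(mat_of_row v * gamma_mat w m (m + n)) $$ (0, k)
    = (\<Sum>i\<le>k. scaled_coeff m v i * scaled_coeff n w (k - i)) / real ((m + n) choose k)"
proof -
  \<comment> \<open>The guard is essential: for \<open>i > k\<close> the truncated
    \<open>k - i\<close> would be 0 and pick up the leading coefficient of \<open>w\<close>.\<close>
  let ?t = "\<lambda>i. if i \<le> k
    then scaled_coeff m v i * scaled_coeff n w (k - i) / real ((m + n) choose k) else 0"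
  have "(mat_of_row v * gamma_mat w m (m + n)) $$ (0, k) = (\<Sum>i\<le>m. ?t i)"
    using v k
    by (auto simp: scalar_prod_def gamma_mat_def lifting_mat_def scaled_coeff_def
        coeff_ext_def atLeast0LessThan lessThan_Suc_atMost nat_diff_distrib of_nat_diff mult_ac
        intro!: sum.cong)
  \<comment> \<open>Either of \<open>m\<close> and \<open>k\<close> may be the larger, so the range
    passes through a common bound: terms with \<open>i > m\<close> vanish by the binomial, those
    with \<open>i > k\<close> by the guard.\<close>
  also have "\<dots> = (\<Sum>i\<le>m + k. ?t i)"
    by (rule sum.mono_neutral_left) (auto simp: scaled_coeff_eq_0)
  also have "\<dots> = (\<Sum>i\<le>k. ?t i)"
    by (rule sum.mono_neutral_right) auto
  finally show ?thesis
    by (simp add: sum_divide_distrib)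
qed

theorem theorem5p7:
  fixes a b :: real and m n :: nat
    and \<xi> \<psi> :: "real vec" and \<Xi> \<Psi> :: "real \<Rightarrow> real"
  assumes "a < b"
    and "\<xi> \<in> carrier_vec (m + 1)"
    and "\<psi> \<in> carrier_vec (n + 1)"
    and "\<forall>x. \<Xi> x = \<xi> \<bullet> bernstein_vec a b m x"
    and "\<forall>x. \<Psi> x = \<psi> \<bullet> bernstein_vec a b n x"
  shows "\<exists>c \<in> carrier_vec (m + n + 1).
           (\<forall>x. \<Xi> x * \<Psi> x = c \<bullet> bernstein_vec a b (m + n) x) \<and>
           mat_of_row c = mat_of_row \<xi> * gamma_mat \<psi> m (m + n) \<and>
           mat_of_row c = mat_of_row \<psi> * gamma_mat \<xi> n (m + n)"
proof -
  \<comment> \<open>The witness \<open>c\<close> is built from the symmetric sum \<open>s\<close>,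
    so that a single vector serves both matrix forms.\<close>
  define s where "s k = (\<Sum>i\<le>k. scaled_coeff m \<xi> i * scaled_coeff n \<psi> (k - i))" for k
  define c where "c = vec (m + n + 1) (\<lambda>k. s k / real ((m + n) choose k))"
  have c: "c \<in> carrier_vec (m + n + 1)"
    by (simp add: c_def)
  have s_flip: "s k = (\<Sum>i\<le>k. scaled_coeff n \<psi> i * scaled_coeff m \<xi> (k - i))" for k
    unfolding s_def
    by (rule sum.reindex_bij_witness [of _ "\<lambda>i. k - i" "\<lambda>i. k - i"]) auto
  \<comment> \<open>Scaling cancels the division in \<open>c\<close>, since the binomial is nonzero
    in this range.\<close>
  have scaled_c: "scaled_coeff (m + n) c k = s k" if "k \<le> m + n" for k
    using that by (simp add: scaled_coeff_def coeff_ext_def c_def)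
  have "\<Xi> x * \<Psi> x = c \<bullet> bernstein_vec a b (m + n) x" for x
  proof -
    let ?p = "\<lambda>N f. \<Sum>i\<le>N. f i * ((x - a) ^ i * (b - x) ^ (N - i))"
    have "\<Xi> x * \<Psi> x
        = ?p m (scaled_coeff m \<xi>) * ?p n (scaled_coeff n \<psi>) / (b - a) ^ (m + n)"
      by (simp only: assms scalar_prod_bernstein_vec power_add times_divide_times_eq)
    also have "\<dots> = ?p (m + n) s / (b - a) ^ (m + n)"
      unfolding s_def by (subst homogeneous_product) (simp_all add: scaled_coeff_eq_0)
    also have "\<dots> = ?p (m + n) (scaled_coeff (m + n) c) / (b - a) ^ (m + n)"
      by (simp add: scaled_c)
    finally show ?thesis
      by (simp only: scalar_prod_bernstein_vec [OF c])
  qed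
  moreover have "mat_of_row c = mat_of_row \<xi> * gamma_mat \<psi> m (m + n)"
  proof (rule eq_matI)
    fix i j assume "i < dim_row (mat_of_row \<xi> * gamma_mat \<psi> m (m + n))"
      and "j < dim_col (mat_of_row \<xi> * gamma_mat \<psi> m (m + n))"
    then have "i = 0" "j \<le> m + n"
      by (simp_all add: gamma_mat_def)
    then show "mat_of_row c $$ (i, j) = (mat_of_row \<xi> * gamma_mat \<psi> m (m + n)) $$ (i, j)"
      using row_times_gamma_mat [OF assms(2), of j n \<psi>] by (simp add: c_def s_def)
  qed (simp_all add: c_def gamma_mat_def)
  moreover have "mat_of_row c = mat_of_row \<psi> * gamma_mat \<xi> n (m + n)"
  proof (rule eq_matI)
    fix i j assume "i < dim_row (mat_of_row \<psi> * gamma_mat \<xi> n (m + n))"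
      and "j < dim_col (mat_of_row \<psi> * gamma_mat \<xi> n (m + n))"
    then have "i = 0" "j \<le> m + n"
      by (simp_all add: gamma_mat_def)
    \<comment> \<open>With the factors exchanged, the row formula yields the reflected sum of
      \<open>s_flip\<close> and the degree as \<open>n + m\<close>.\<close>
    then show "mat_of_row c $$ (i, j) = (mat_of_row \<psi> * gamma_mat \<xi> n (m + n)) $$ (i, j)"
      using row_times_gamma_mat [OF assms(3), of j m \<xi>]
      by (simp add: c_def s_flip add.commute [of n m])
  qed (simp_all add: c_def gamma_mat_def)
  ultimately show ?thesis
    using c by blast
qed

end
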